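(* There exist constants $\xi_1,\xi_2$ with $1<\xi_1<\xi_2<4$ such that for all sufficiently large $m$ of the form $m=pq\in J$ with $p,q$ odd primes, $p<q<4p$: (1) if $1<\frac{q}{p}<\xi_1$ then $m$ is exceptional; (2) if $\xi_2<\frac{q}{p}<4$ then $m$ is ordinary.
   Context: For odd $m\ge 3$ let $\mathbb{Z}_m=\mathbb{Z}/m\mathbb{Z}$. A Cayley subset of $\mathbb{Z}_m$ is a subset $S$ with $0\notin S$, $S=-S$, generating $\mathbb{Z}_m$. $X(S)$ is the Cayley graph on $\mathbb{Z}_m$ ($x\sim y$ iff $y-x\in S$), with non-trivial eigenvalues $\mu_j(S)=\sum_{a\in S}e^{2\pi i a j/m}$ ($1\le j\le m-1$) and $\mu(S)=\max_j|\mu_j(S)|$; it is Ramanujan if $\mu(S)\le 2\sqrt{|S|-1}$. The covalency is $l(S)=m-|S|$. $\hat{l}$ is the largest covalency value $l$ such that $X(S)$ is Ramanujan for every Cayley subset $S$ with $l(S)\le l$. Let $l_0=2\lfloor\sqrt{m}-\frac32\rfloor+1$; for $m\ge 15$, $\hat l\in\{l_0,l_0+2\}$ and $m$ is ordinary if $\hat{l}=l_0$, exceptional if $\hat l=l_0+2$. $J=\{2n+1: 7\le n\le 14\}\cup\{k^2+5k+c: k\ge 4,\ c\in\{\pm1,\pm3,5\}\}\cup\{k^2+5k-5: k\ge 19\}$. *)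

theory Defs
  imports
    "HOL-Analysis.Analysis"
    "HOL-Algebra.Elementary_Groups"
    "HOL-Algebra.Generated_Groups"
    "HOL-Computational_Algebra.Primes"
begin

text \<open>The group \<open>\<int>/m\<int>\<close> is \<^const>\<open>integer_mod_group\<close>, whose carrier is \<open>{0..<int m}\<close> for \<open>m > 0\<close>.\<close>

definition cayley_subset :: "nat \<Rightarrow> int set \<Rightarrow> bool" where
  "cayley_subset m S \<longleftrightarrow>
     S \<subseteq> carrier (integer_mod_group m) \<and> 0 \<notin> S \<and>
     (\<lambda>a. inv\<^bsub>integer_mod_group m\<^esub> a) ` S = S \<and>
     generate (integer_mod_group m) S = carrier (integer_mod_group m)"

definition cayley_adj :: "nat \<Rightarrow> int set \<Rightarrow> int \<Rightarrow> int \<Rightarrow> bool" where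
  "cayley_adj m S x y \<longleftrightarrow> (y - x) mod int m \<in> S"

definition zm_char :: "nat \<Rightarrow> nat \<Rightarrow> int \<Rightarrow> complex" where
  "zm_char m j a = exp (2 * complex_of_real pi * \<i> * of_int a * of_nat j / of_nat m)"

definition cayley_eigenvalue :: "nat \<Rightarrow> int set \<Rightarrow> nat \<Rightarrow> complex" where
  "cayley_eigenvalue m S j =
     (\<Sum>a\<in>S. exp (2 * complex_of_real pi * \<i> * of_int a * of_nat j / of_nat m))"

lemma zm_char_mod: "m > 0 \<Longrightarrow> zm_char m j (a mod int m) = zm_char m j a"
proof -
  assume m: "m > 0"
  have "of_int a = (of_int (a mod int m) + of_nat m * of_int (a div int m) :: complex)"
    by (metis mod_mult_div_eq of_int_add of_int_mult of_int_of_nat_eq)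
  then have "2 * complex_of_real pi * \<i> * of_int a * of_nat j / of_nat m =
      2 * complex_of_real pi * \<i> * of_int (a mod int m) * of_nat j / of_nat m
      + 2 * of_int (a div int m * int j) * complex_of_real pi * \<i>"
    using m by (simp add: field_simps)
  then show ?thesis
    unfolding zm_char_def
    by (simp only: exp_add exp_integer_2pi[OF Ints_of_int, simplified] mult_1_right)
qed

text \<open>The numbers \<open>cayley_eigenvalue m S j\<close> are the eigenvalues of the adjacency operator of the
  Cayley graph, with the characters as eigenvectors; \<open>j = 0\<close> gives the trivial one, \<open>card S\<close>.\<close>

lemma cayley_eigenvalue_eigenvector:
  assumes m: "m > 0" and S: "S \<subseteq> {0..<int m}" and x: "x \<in> {0..<int m}"
  shows "(\<Sum>y | y \<in> {0..<int m} \<and> cayley_adj m S x y. zm_char m j y)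
         = cayley_eigenvalue m S j * zm_char m j x"
proof -
  have "(\<Sum>y | y \<in> {0..<int m} \<and> cayley_adj m S x y. zm_char m j y)
      = (\<Sum>a\<in>S. zm_char m j (a + x))"
  proof (rule sum.reindex_bij_witness[where i = "\<lambda>a. (a + x) mod int m" and j = "\<lambda>y. (y - x) mod int m"])
    fix a assume "a \<in> S"
    then have "a mod int m = a" using S by auto
    then show "((a + x) mod int m - x) mod int m = a" by (simp add: mod_simps)
    then show "(a + x) mod int m \<in> {y. y \<in> {0..<int m} \<and> cayley_adj m S x y}"
      using m \<open>a \<in> S\<close> by (simp add: cayley_adj_def)
  next
    fix y assume y: "y \<in> {y. y \<in> {0..<int m} \<and> cayley_adj m S x y}"
    then show "((y - x) mod int m + x) mod int m = y" by (simp add: mod_simps)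
    show "(y - x) mod int m \<in> S" using y by (simp add: cayley_adj_def)
    have "zm_char m j (((y - x) mod int m + x) mod int m) = zm_char m j y"
      using y by (simp add: mod_simps)
    then show "zm_char m j ((y - x) mod int m + x) = zm_char m j y"
      using zm_char_mod[OF m] by simp
  qed
  also have "\<dots> = (\<Sum>a\<in>S. zm_char m j a * zm_char m j x)"
    by (rule sum.cong) (simp_all add: zm_char_def exp_add [symmetric] field_simps add_divide_distrib)
  finally show ?thesis
    by (simp add: cayley_eigenvalue_def zm_char_def sum_distrib_right)
qed

definition cayley_mu :: "nat \<Rightarrow> int set \<Rightarrow> real" where
  "cayley_mu m S = Max ((\<lambda>j. cmod (cayley_eigenvalue m S j)) ` {1..m - 1})"

definition ramanujan :: "nat \<Rightarrow> int set \<Rightarrow> bool" where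
  "ramanujan m S \<longleftrightarrow> cayley_mu m S \<le> 2 * sqrt (real (card S) - 1)"

definition covalency :: "nat \<Rightarrow> int set \<Rightarrow> nat" where
  "covalency m S = m - card S"

definition l_hat :: "nat \<Rightarrow> nat" where
  "l_hat m = Max {l \<in> covalency m ` {S. cayley_subset m S}.
     \<forall>S. cayley_subset m S \<and> covalency m S \<le> l \<longrightarrow> ramanujan m S}"

definition l_zero :: "nat \<Rightarrow> int" where
  "l_zero m = 2 * \<lfloor>sqrt (real m) - 3 / 2\<rfloor> + 1"

definition ordinary :: "nat \<Rightarrow> bool" where
  "ordinary m \<longleftrightarrow> odd m \<and> m \<ge> 15 \<and> int (l_hat m) = l_zero m"

definition exceptional :: "nat \<Rightarrow> bool" where
  "exceptional m \<longleftrightarrow> odd m \<and> m \<ge> 15 \<and> int (l_hat m) = l_zero m + 2"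

definition J_set :: "int set" where
  "J_set = {2 * n + 1 | n. 7 \<le> n \<and> n \<le> 14}
         \<union> {k\<^sup>2 + 5 * k + c | k c. k \<ge> 4 \<and> c \<in> {1, -1, 3, -3, 5}}
         \<union> {k\<^sup>2 + 5 * k - 5 | k. k \<ge> 19}"

end

theory Submission
  imports Defs "HOL-Number_Theory.Cong" "HOL-Real_Asymp.Real_Asymp"
begin

text \<open>
  If \<open>T\<close> is the complement of a Cayley subset \<open>S\<close> and \<open>l = |T|\<close>, then \<open>|\<mu>\<^sub>j(S)| = |\<Sum>a\<in>T. cos (2 \<pi> a j / m)| \<le> l\<close>, and
  \<open>l\<^sub>0\<close> is the largest odd \<open>l\<close> with \<open>l \<le> 2 sqrt (m - l - 1)\<close>. Write \<open>m = k\<^sup>2 + 5 k + c\<close> with \<open>|c| \<le> 5\<close>, so that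
  \<open>l\<^sub>0 = 2 k + 1\<close>. At \<open>l = 2 k + 3\<close> the Ramanujan bound is \<open>l - \<delta> / (2 l)\<close> up to lower order, where
  \<open>\<delta> = 25 - 4 c\<close> lies between \<open>5\<close> and \<open>45\<close>. The cosine sum loses at least about \<open>4 \<pi>\<^sup>2 / (3 k)\<close> against \<open>l\<close> when
  \<open>j\<close> is prime to \<open>m\<close> (the extremal \<open>T\<close> is an interval around \<open>0\<close>), and at least
  \<open>(l - m / d) (1 - cos (2 \<pi> / d))\<close> when \<open>j\<close> has order \<open>d \<in> {p, q}\<close>. For \<open>q / p\<close> near \<open>1\<close> all these losses exceed
  \<open>45 / (4 k)\<close>. For \<open>q / p\<close> near \<open>4\<close> the loss for \<open>d = p\<close> is attained by the multiples of \<open>p\<close> together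
  with a few elements congruent to \<open>1\<close> or \<open>-1\<close> modulo \<open>p\<close>, and it is below \<open>5 / (4 k)\<close> since \<open>l - q\<close> is small.
\<close>

section \<open>Covalency and cosine sums\<close>

text \<open>Neither generation nor \<open>0 \<notin> T\<close> is asked for, so that the notion
  passes from a Cayley subset to its complement.\<close>

definition symmetric_residues :: "nat \<Rightarrow> int set \<Rightarrow> bool" where
  "symmetric_residues m T \<longleftrightarrow> T \<subseteq> {0..<int m} \<and> (\<forall>a\<in>T. (- a) mod int m \<in> T)"

lemma symmetric_residues_finite: "symmetric_residues m T \<Longrightarrow> finite T"
  unfolding symmetric_residues_def by (meson finite_atLeastLessThan_int finite_subset)

lemma neg_mod_neg_mod: "a \<in> {0..<int m} \<Longrightarrow> (- ((- a) mod int m)) mod int m = a"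
  by (simp add: mod_minus_eq)

lemma neg_mod_residue: "0 < a \<Longrightarrow> a < int m \<Longrightarrow> (- a) mod int m = int m - a"
  by (simp add: zmod_zminus1_eq_if)

lemma symmetric_residues_compl:
  assumes "m > 0" "symmetric_residues m T"
  shows "symmetric_residues m ({0..<int m} - T)"
  using assms neg_mod_neg_mod[of _ m] unfolding symmetric_residues_def by fastforce

lemma zm_char_cis: "zm_char m j a = cis (2 * pi * of_int a * of_nat j / of_nat m)"
  by (simp add: zm_char_def cis_conv_exp mult_ac)

lemma Re_zm_char: "Re (zm_char m j a) = cos (2 * pi * of_int a * of_nat j / of_nat m)"
  by (simp add: zm_char_cis)

lemma zm_char_neg_mod: "m > 0 \<Longrightarrow> zm_char m j ((- a) mod int m) = cnj (zm_char m j a)"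
  by (simp add: zm_char_mod) (simp add: zm_char_cis cis_cnj)

lemma zm_char_nat_power: "zm_char m j (int n) = zm_char m j 1 ^ n"
  unfolding zm_char_cis Complex.DeMoivre by (rule arg_cong[of _ _ cis]) simp

lemma zm_char_eq_1_iff:
  assumes "m > 0"
  shows "zm_char m j a = 1 \<longleftrightarrow> int m dvd a * int j"
proof
  assume "zm_char m j a = 1"
  then have "cos (2 * pi * of_int a * of_nat j / of_nat m) = 1"
    by (simp add: Re_zm_char [symmetric])
  then obtain n :: int where "2 * pi * of_int a * of_nat j / of_nat m = of_int n * 2 * pi"
    by (metis cos_one_2pi_int)
  then have "pi * (real_of_int a * real j) = pi * (of_int n * real m)"
    using assms by (simp add: field_simps)
  then have "real_of_int (a * int j) = real_of_int (n * int m)"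
    using pi_neq_zero by (metis mult_cancel_left of_int_mult of_int_of_nat_eq)
  then show "int m dvd a * int j"
    by (metis dvd_triv_right of_int_eq_iff)
next
  assume "int m dvd a * int j"
  then obtain n where n: "a * int j = int m * n" ..
  then have "of_int a * of_nat j = (of_nat m * of_int n :: real)"
    by (metis of_int_mult of_int_of_nat_eq)
  then have "2 * pi * of_int a * of_nat j / of_nat m = 2 * pi * of_int n"
    using assms by (simp add: field_simps)
  then show "zm_char m j a = 1"
    by (simp add: zm_char_cis)
qed

text \<open>A geometric sum whose ratio is an \<open>m\<close>-th root of unity other than
  \<open>1\<close>.\<close>

lemma sum_zm_char_all:
  assumes "1 \<le> j" "j \<le> m - 1"
  shows "(\<Sum>a\<in>{0..<int m}. zm_char m j a) = 0"
proof -
  have m: "m > 0" using assms by simp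
  have *: "{0..<int m} = int ` {..<m}"
    by (simp add: atLeast0LessThan [symmetric] image_int_atLeastLessThan)
  have "zm_char m j 1 \<noteq> 1"
    using assms zdvd_imp_le[of "int m" "int j"] by (auto simp: zm_char_eq_1_iff[OF m])
  moreover have "zm_char m j 1 ^ m = 1"
    using zm_char_eq_1_iff[OF m, of j "int m"] by (simp add: zm_char_nat_power)
  ultimately have "(\<Sum>n<m. zm_char m j 1 ^ n) = 0"
    by (simp add: geometric_sum)
  then show ?thesis
    by (simp add: * sum.reindex zm_char_nat_power)
qed

text \<open>The full character sum vanishes, so the sum over \<open>S\<close> is minus the sum over
  the complement. Negation permutes the complement and conjugates the character, hence that sum is
  real.\<close>

lemma norm_cayley_eigenvalue:
  assumes "1 \<le> j" "j \<le> m - 1" and S: "symmetric_residues m S"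
  shows "cmod (cayley_eigenvalue m S j) = \<bar>\<Sum>a\<in>{0..<int m} - S. Re (zm_char m j a)\<bar>"
proof -
  have m: "m > 0" using assms by simp
  define T where "T = {0..<int m} - S"
  have T: "symmetric_residues m T"
    using symmetric_residues_compl[OF m S] by (simp add: T_def)
  have "(\<Sum>a\<in>S. zm_char m j a) + (\<Sum>a\<in>T. zm_char m j a) = (\<Sum>a\<in>{0..<int m}. zm_char m j a)"
    using S unfolding T_def symmetric_residues_def by (metis add.commute finite_atLeastLessThan_int sum.subset_diff)
  then have "cayley_eigenvalue m S j = - (\<Sum>a\<in>T. zm_char m j a)"
    using sum_zm_char_all[OF assms(1,2)]
    by (simp add: cayley_eigenvalue_def zm_char_def eq_neg_iff_add_eq_0)
  moreover have "(\<Sum>a\<in>T. zm_char m j a) = (\<Sum>a\<in>T. cnj (zm_char m j a))"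
    by (rule sum.reindex_bij_witness[where i = "\<lambda>a. (- a) mod int m" and j = "\<lambda>a. (- a) mod int m"])
       (use T m in \<open>auto simp: symmetric_residues_def neg_mod_neg_mod zm_char_neg_mod subset_iff\<close>)
  then have "Im (\<Sum>a\<in>T. zm_char m j a) = 0"
    by (metis cnj_sum cnj.sel(2) equal_neg_zero)
  ultimately show ?thesis
    by (simp add: T_def norm_complex_def)
qed

text \<open>For odd \<open>m\<close> negation fixes no nonzero residue, so \<open>S\<close> consists
  of its elements below \<open>m / 2\<close> and their mirror images.\<close>

lemma card_symmetric_residues_even:
  assumes "odd m" and S: "symmetric_residues m S" and "0 \<notin> S"
  shows "even (card S)"
proof -
  define P where "P = {a\<in>S. 2 * a < int m}"
  have fin: "finite S" using S by (rule symmetric_residues_finite)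
  have pos: "0 < a \<and> a < int m" if "a \<in> S" for a
    using S that \<open>0 \<notin> S\<close> unfolding symmetric_residues_def
    by (metis atLeastLessThan_iff order_le_less subset_iff)
  have neg: "int m - a \<in> S" if "a \<in> S" for a
    using S that pos[OF that] neg_mod_residue[of a m] unfolding symmetric_residues_def by force
  have ne: "2 * a \<noteq> int m" for a using \<open>odd m\<close> by (metis even_mult_iff even_numeral even_of_nat)
  have "S = P \<union> (\<lambda>a. int m - a) ` P"
  proof
    show "S \<subseteq> P \<union> (\<lambda>a. int m - a) ` P"
    proof
      fix a assume a: "a \<in> S"
      show "a \<in> P \<union> (\<lambda>a. int m - a) ` P"
      proof (cases "2 * a < int m")
        case False
        then have "int m - a \<in> P" using neg[OF a] ne[of a] by (auto simp: P_def)
        then show ?thesis by (metis UnI2 diff_diff_eq2 add_diff_cancel_left' image_eqI)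
      qed (use a in \<open>simp add: P_def\<close>)
    qed
  qed (use neg in \<open>auto simp: P_def\<close>)
  moreover have "P \<inter> (\<lambda>a. int m - a) ` P = {}" by (auto simp: P_def)
  moreover have "card ((\<lambda>a. int m - a) ` P) = card P" by (rule card_image) (auto intro: inj_onI)
  moreover have "finite P" using fin by (simp add: P_def)
  ultimately have "card S = card P + card P"
    by (metis card_Un_disjoint finite_imageI)
  then show ?thesis by simp
qed

lemma cayley_subset_symmetric:
  assumes "m > 0" "cayley_subset m S"
  shows "symmetric_residues m S"
proof -
  have sub: "S \<subseteq> {0..<int m}" and im: "(\<lambda>a. inv\<^bsub>integer_mod_group m\<^esub> a) ` S = S"
    using assms by (auto simp: cayley_subset_def carrier_integer_mod_group)
  have "(- a) mod int m \<in> S" if "a \<in> S" for a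
  proof -
    have "inv\<^bsub>integer_mod_group m\<^esub> a = (- a) mod int m"
      using that sub assms(1) by (intro inv_integer_mod_group) (auto simp: carrier_integer_mod_group)
    then show ?thesis using im that by (metis imageI)
  qed
  with sub show ?thesis by (simp add: symmetric_residues_def)
qed

lemma cayley_subset_card_covalency:
  assumes "m > 0" "cayley_subset m S"
  shows "card S + covalency m S = m" "card ({0..<int m} - S) = covalency m S" "covalency m S > 0"
proof -
  have sub: "S \<subseteq> {0..<int m}" and 0: "0 \<notin> S"
    using assms by (auto simp: cayley_subset_def carrier_integer_mod_group)
  have "card S \<le> m" using card_mono[OF _ sub] by simp
  then show "card S + covalency m S = m" by (simp add: covalency_def)
  show c: "card ({0..<int m} - S) = covalency m S"
    using card_Diff_subset[OF finite_subset[OF sub] sub] by (simp add: covalency_def)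
  have "0 \<in> {0..<int m} - S" using assms 0 by simp
  then show "covalency m S > 0"
    by (metis c card_gt_0_iff empty_iff finite_Diff finite_atLeastLessThan_int)
qed

lemma odd_covalency:
  assumes "odd m" "cayley_subset m S"
  shows "odd (covalency m S)"
proof -
  have m: "m > 0" using assms by (simp add: odd_pos)
  have "0 \<notin> S" using assms by (simp add: cayley_subset_def)
  then have "even (card S)"
    using card_symmetric_residues_even[OF assms(1) cayley_subset_symmetric[OF m assms(2)]] by blast
  then show ?thesis using cayley_subset_card_covalency(1)[OF m assms(2)] assms(1)
    by (metis even_add)
qed

text \<open>More than half of the residues generate by pigeonhole: \<open>S\<close> meets \<open>x - S\<close>.\<close>

lemma cayley_subset_compl:
  assumes m: "m > 0" and T: "symmetric_residues m T" "0 \<in> T" "2 * card T < m"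
  shows "cayley_subset m ({0..<int m} - T)" "covalency m ({0..<int m} - T) = card T"
proof -
  define S where "S = {0..<int m} - T"
  have sub: "T \<subseteq> {0..<int m}" using T by (simp add: symmetric_residues_def)
  have finT: "finite T" using T by (simp add: symmetric_residues_finite)
  have cardS: "card S = m - card T"
    using card_Diff_subset[OF finT sub] by (simp add: S_def)
  have S: "symmetric_residues m S" using symmetric_residues_compl[OF m T(1)] by (simp add: S_def)
  then have inv: "inv\<^bsub>integer_mod_group m\<^esub> a = (- a) mod int m" if "a \<in> S" for a
    using that m by (intro inv_integer_mod_group) (auto simp: carrier_integer_mod_group symmetric_residues_def)
  have im: "(\<lambda>a. inv\<^bsub>integer_mod_group m\<^esub> a) ` S = S"
  proof -
    have "(\<lambda>a. inv\<^bsub>integer_mod_group m\<^esub> a) ` S = (\<lambda>a. (- a) mod int m) ` S"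
      using inv by (intro image_cong) auto
    also have "\<dots> = S"
    proof
      show "S \<subseteq> (\<lambda>a. (- a) mod int m) ` S"
      proof
        fix a assume a: "a \<in> S"
        then have "a = (- ((- a) mod int m)) mod int m"
          using S by (subst neg_mod_neg_mod) (auto simp: symmetric_residues_def)
        then show "a \<in> (\<lambda>a. (- a) mod int m) ` S"
          using S a unfolding symmetric_residues_def by (metis imageI)
      qed
    qed (use S in \<open>auto simp: symmetric_residues_def\<close>)
    finally show ?thesis .
  qed
  have gen: "generate (integer_mod_group m) S = {0..<int m}"
  proof
    show "generate (integer_mod_group m) S \<subseteq> {0..<int m}"
      using group.generate_incl[OF group_integer_mod_group, of S m] S m
      by (simp add: symmetric_residues_def carrier_integer_mod_group)
    show "{0..<int m} \<subseteq> generate (integer_mod_group m) S"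
    proof
      fix x assume x: "x \<in> {0..<int m}"
      let ?f = "\<lambda>a. (x - a) mod int m"
      have ff: "?f (?f a) = a" if "a \<in> S" for a
        using that by (simp add: S_def mod_simps)
      then have "card (?f ` S) = card S" by (intro card_image inj_on_inverseI[where g = ?f])
      moreover have "?f ` S \<subseteq> {0..<int m}" "S \<subseteq> {0..<int m}" using m by (auto simp: S_def)
      ultimately have "S \<inter> ?f ` S \<noteq> {}"
        using card_Un_disjoint[of S "?f ` S"] card_mono[of "{0..<int m}" "S \<union> ?f ` S"] T(3) cardS
        by (auto simp: finite_subset)
      then obtain a where a: "a \<in> S" "?f a \<in> S" by blast
      have "a \<otimes>\<^bsub>integer_mod_group m\<^esub> ?f a \<in> generate (integer_mod_group m) S"
        using a by (intro generate.eng generate.incl)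
      then show "x \<in> generate (integer_mod_group m) S"
        using x by (simp add: mod_simps)
    qed
  qed
  show "cayley_subset m ({0..<int m} - T)"
    using im gen m T(2) by (simp add: cayley_subset_def carrier_integer_mod_group flip: S_def) (simp add: S_def)
  show "covalency m ({0..<int m} - T) = card T"
    using cardS T(3) by (simp add: covalency_def S_def)
qed

text \<open>\<open>S'\<close> rules out every value from \<open>l + 2\<close> on, and covalencies
  are odd, so \<open>l + 1\<close> does not occur.\<close>

lemma l_hat_eqI:
  assumes m: "odd m"
    and ex: "cayley_subset m S" "covalency m S = l"
    and good: "\<And>S. cayley_subset m S \<Longrightarrow> covalency m S \<le> l \<Longrightarrow> ramanujan m S"
    and bad: "cayley_subset m S'" "covalency m S' = l + 2" "\<not> ramanujan m S'"
  shows "l_hat m = l"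
  unfolding l_hat_def
proof (rule Max_eqI)
  let ?C = "{S. cayley_subset m S}"
  have "?C \<subseteq> Pow {0..<int m}"
    using m by (auto simp: cayley_subset_def carrier_integer_mod_group odd_pos)
  then have "finite ?C" by (rule finite_subset) simp
  then show "finite {l \<in> covalency m ` ?C. \<forall>S. cayley_subset m S \<and> covalency m S \<le> l \<longrightarrow> ramanujan m S}"
    by simp
  show "l \<in> {l \<in> covalency m ` ?C. \<forall>S. cayley_subset m S \<and> covalency m S \<le> l \<longrightarrow> ramanujan m S}"
    using ex good by blast
  fix l' assume l': "l' \<in> {l \<in> covalency m ` ?C. \<forall>S. cayley_subset m S \<and> covalency m S \<le> l \<longrightarrow> ramanujan m S}"
  then have "\<not> l + 2 \<le> l'" using bad by force
  moreover have "odd l'" using l' odd_covalency[OF m] by auto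
  moreover have "odd l" using ex odd_covalency[OF m] by auto
  ultimately show "l' \<le> l" by presburger
qed

lemma ramanujan_iff:
  assumes m: "m \<ge> 2" and S: "cayley_subset m S"
  shows "ramanujan m S \<longleftrightarrow> (\<forall>j\<in>{1..m-1}. \<bar>\<Sum>a\<in>{0..<int m} - S. Re (zm_char m j a)\<bar>
           \<le> 2 * sqrt (real m - real (covalency m S) - 1))"
proof -
  have "m > 0" using m by simp
  have "real (card S) = real m - real (covalency m S)"
    using cayley_subset_card_covalency(1)[OF \<open>m > 0\<close> S] by linarith
  then have "ramanujan m S \<longleftrightarrow> (\<forall>j\<in>{1..m-1}. cmod (cayley_eigenvalue m S j)
           \<le> 2 * sqrt (real m - real (covalency m S) - 1))"
    using m unfolding ramanujan_def cayley_mu_def by (subst Max_le_iff) auto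
  then show ?thesis
    using norm_cayley_eigenvalue[OF _ _ cayley_subset_symmetric[OF \<open>m > 0\<close> S]] by simp
qed

section \<open>Extremal cosine sums for characters of full order\<close>

text \<open>Subtracting \<open>c\<close> from \<open>f\<close> costs both sums the same, since the
  cardinalities agree. Afterwards all terms on \<open>I\<close> are nonnegative and all terms
  outside are nonpositive.\<close>

lemma sum_le_sum_superlevel:
  fixes f :: "'a \<Rightarrow> real"
  assumes "finite A" "T \<subseteq> A" "I \<subseteq> A" "card T = card I"
    and ge: "\<And>x. x \<in> I \<Longrightarrow> c \<le> f x" and le: "\<And>x. x \<in> A - I \<Longrightarrow> f x \<le> c"
  shows "sum f T \<le> sum f I"
proof -
  have fin: "finite T" "finite I" using assms finite_subset by blast+
  have "(\<Sum>x\<in>T. f x - c) = (\<Sum>x\<in>T \<inter> I. f x - c) + (\<Sum>x\<in>T - I. f x - c)"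
    by (rule sum.Int_Diff[OF fin(1)])
  also have "\<dots> \<le> (\<Sum>x\<in>I. f x - c) + 0"
    using assms fin by (intro add_mono sum_mono2 sum_nonpos) auto
  finally show ?thesis using assms(4) by (simp add: sum_subtractf)
qed

section \<open>Monotonicity and Taylor bounds of the cosine\<close>

lemma cos_le_of_between:
  assumes "0 \<le> x" "x \<le> y" "y \<le> 2 * pi - x"
  shows "cos y \<le> cos x"
proof (cases "y \<le> pi")
  case True
  then show ?thesis using assms by (intro cos_monotone_0_pi_le) auto
next
  case False
  then have "cos (2 * pi - y) \<le> cos x" using assms by (intro cos_monotone_0_pi_le) auto
  then show ?thesis by (simp add: cos_diff)
qed

lemma cos_fraction_antimono:
  fixes x y m :: real
  assumes "0 < m" "0 \<le> x" "x \<le> y" "y \<le> m - x"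
  shows "cos (2 * pi * y / m) \<le> cos (2 * pi * x / m)"
proof (rule cos_le_of_between)
  have "2 * pi * y / m \<le> 2 * pi * (m - x) / m"
    using assms by (intro divide_right_mono mult_left_mono) auto
  then show "2 * pi * y / m \<le> 2 * pi - 2 * pi * x / m"
    using assms(1) by (simp add: right_diff_distrib diff_divide_distrib)
qed (use assms in \<open>auto intro!: divide_right_mono\<close>)

lemma cos_ge_quadratic: "1 - x\<^sup>2 / 2 \<le> cos x" for x :: real
proof -
  obtain t where "cos x = (\<Sum>m<2. cos_coeff m * x ^ m) + (cos (t + 1/2 * real 2 * pi) / fact 2) * x ^ 2"
    using Maclaurin_cos_expansion[of x 2] by blast
  then have "cos x = 1 - cos t * (x\<^sup>2 / 2)"
    by (simp add: cos_coeff_def numeral_2_eq_2 fact_numeral)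
  moreover have "cos t * (x\<^sup>2 / 2) \<le> 1 * (x\<^sup>2 / 2)" by (intro mult_right_mono) auto
  ultimately show ?thesis by simp
qed

lemma cos_le_quartic: "cos x \<le> 1 - x\<^sup>2 / 2 + x ^ 4 / 24" for x :: real
proof -
  obtain t where "cos x = (\<Sum>m<4. cos_coeff m * x ^ m) + (cos (t + 1/2 * real 4 * pi) / fact 4) * x ^ 4"
    using Maclaurin_cos_expansion[of x 4] by blast
  then have "cos x = 1 - x\<^sup>2 / 2 + cos t * (x ^ 4 / 24)"
    by (simp add: lessThan_nat_numeral lessThan_Suc cos_coeff_def fact_numeral numeral_3_eq_3 [symmetric] cos_add algebra_simps)
  moreover have "cos t * (x ^ 4 / 24) \<le> 1 * (x ^ 4 / 24)" by (intro mult_right_mono) auto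
  ultimately show ?thesis by simp
qed

section \<open>Intervals of residues centred at \<open>0\<close>\<close>

definition residue_interval :: "nat \<Rightarrow> nat \<Rightarrow> int set" where
  "residue_interval m r = {0..int r} \<union> {int m - int r..<int m}"

lemma residue_interval:
  assumes "2 * r < m"
  shows "symmetric_residues m (residue_interval m r)" "0 \<in> residue_interval m r"
    "card (residue_interval m r) = 2 * r + 1"
proof -
  show "symmetric_residues m (residue_interval m r)"
    unfolding symmetric_residues_def
  proof (intro conjI ballI)
    fix a assume a: "a \<in> residue_interval m r"
    show "(- a) mod int m \<in> residue_interval m r"
    proof (cases "a = 0")
      case False
      then have "(- a) mod int m = int m - a"
        using a assms by (intro neg_mod_residue) (auto simp: residue_interval_def)
      then show ?thesis using a False assms by (auto simp: residue_interval_def)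
    qed (use a in simp)
  qed (use assms in \<open>auto simp: residue_interval_def\<close>)
  show "0 \<in> residue_interval m r" by (simp add: residue_interval_def)
  have "{0..int r} \<inter> {int m - int r..<int m} = {}" using assms by auto
  then show "card (residue_interval m r) = 2 * r + 1"
    by (simp add: residue_interval_def card_Un_disjoint)
qed

lemma sum_residue_interval:
  assumes "2 * r < m"
  shows "(\<Sum>a\<in>residue_interval m r. Re (zm_char m 1 a)) = 1 + 2 * (\<Sum>s=1..r. cos (2 * pi * real s / real m))"
proof -
  have m: "m > 0" using assms by simp
  let ?f = "\<lambda>a. Re (zm_char m 1 a)"
  have "{0..int r} \<inter> {int m - int r..<int m} = {}" using assms by auto
  then have "sum ?f (residue_interval m r) = sum ?f {0..int r} + sum ?f {int m - int r..<int m}"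
    unfolding residue_interval_def by (intro sum.union_disjoint) auto
  also have "sum ?f {0..int r} = (\<Sum>s=0..r. ?f (int s))"
    by (rule sum.reindex_bij_witness[where i = int and j = nat]) auto
  also have "\<dots> = 1 + (\<Sum>s=1..r. ?f (int s))"
    by (simp add: sum.atLeast_Suc_atMost Re_zm_char)
  also have "sum ?f {int m - int r..<int m} = (\<Sum>s=1..r. ?f (int s))"
  proof (rule sum.reindex_bij_witness[where i = "\<lambda>s. int m - int s" and j = "\<lambda>a. nat (int m - a)"])
    fix a assume a: "a \<in> {int m - int r..<int m}"
    then have "(- (int m - a)) mod int m = a"
      using assms by (subst neg_mod_residue) auto
    then show "?f (int (nat (int m - a))) = ?f a"
      using zm_char_neg_mod[OF m, of 1 "int m - a"] a by simp
  qed auto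
  finally show ?thesis by (simp add: Re_zm_char)
qed

lemma sum_squares_closed: "(\<Sum>s=1..r. (real s)\<^sup>2) = real r * (real r + 1) * (2 * real r + 1) / 6"
  by (induction r) (simp_all add: algebra_simps power2_eq_square add_divide_distrib)

text \<open>The quartic bound on the cosine, summed over \<open>s\<close>. With
  \<open>pi >= 3\<close> the quadratic loss is at least \<open>18 * s^2 / m^2\<close>; doubling the
  sum of squares gives the factor \<open>6\<close>. With \<open>pi <= 4\<close> the quartic
  coefficient is \<open>16 * 256 / 24 < 171\<close>, doubled to \<open>342\<close>.\<close>

lemma residue_interval_sum_le:
  assumes "2 * r < m"
  shows "(\<Sum>a\<in>residue_interval m r. Re (zm_char m 1 a))
    \<le> 2 * real r + 1 - 6 * real r * (real r + 1) * (2 * real r + 1) / (real m)\<^sup>2 + 342 * real r ^ 5 / real m ^ 4"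
proof -
  have pi: "3 \<le> pi" "pi \<le> 4" using pi_approx by auto
  have m: "real m > 0" using assms by simp
  have "cos (2 * pi * real s / real m) \<le> 1 - 18 * (real s)\<^sup>2 / (real m)\<^sup>2 + 171 * real r ^ 4 / real m ^ 4"
    if s: "s \<in> {1..r}" for s
  proof -
    let ?x = "2 * pi * real s / real m"
    have "3\<^sup>2 \<le> pi\<^sup>2" using pi by (intro power_mono) auto
    then have "9 * (2 * (real s)\<^sup>2 / (real m)\<^sup>2) \<le> pi\<^sup>2 * (2 * (real s)\<^sup>2 / (real m)\<^sup>2)"
      by (intro mult_right_mono) auto
    then have 1: "18 * (real s)\<^sup>2 / (real m)\<^sup>2 \<le> ?x\<^sup>2 / 2"
      by (simp add: power_divide power_mult_distrib mult_ac)
    have "pi ^ 4 \<le> 4 ^ 4" using pi by (intro power_mono) auto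
    moreover have "real s ^ 4 \<le> real r ^ 4" using s by (intro power_mono) auto
    ultimately have "pi ^ 4 * real s ^ 4 \<le> 256 * real r ^ 4" by (intro mult_mono) auto
    then have "?x ^ 4 / 24 \<le> 16 * (256 * real r ^ 4) / real m ^ 4 / 24"
      by (simp add: power_divide power_mult_distrib divide_right_mono)
    also have "\<dots> \<le> 171 * real r ^ 4 / real m ^ 4"
      using m by (simp add: field_simps)
    finally show ?thesis using 1 cos_le_quartic[of ?x] by linarith
  qed
  then have "(\<Sum>s=1..r. cos (2 * pi * real s / real m))
    \<le> (\<Sum>s=1..r. 1 - 18 * (real s)\<^sup>2 / (real m)\<^sup>2 + 171 * real r ^ 4 / real m ^ 4)"
    by (rule sum_mono)
  also have "\<dots> = real r - 18 * (\<Sum>s=1..r. (real s)\<^sup>2) / (real m)\<^sup>2 + 171 * real r ^ 5 / real m ^ 4"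
    by (simp add: sum.distrib sum_subtractf sum_divide_distrib sum_distrib_left eval_nat_numeral)
  finally show ?thesis
    unfolding sum_residue_interval[OF assms] sum_squares_closed by simp
qed

text \<open>Each of the \<open>2 * r\<close> nonzero elements loses at most
  \<open>32 * r^2 / m^2\<close>, by the quadratic bound and \<open>pi <= 4\<close>.\<close>

lemma residue_interval_sum_ge:
  assumes "2 * r < m"
  shows "(\<Sum>a\<in>residue_interval m r. Re (zm_char m 1 a)) \<ge> 2 * real r + 1 - 64 * real r ^ 3 / (real m)\<^sup>2"
proof -
  have pi: "pi \<le> 4" using pi_approx by auto
  have m: "real m > 0" using assms by simp
  have "1 - 32 * (real r)\<^sup>2 / (real m)\<^sup>2 \<le> cos (2 * pi * real s / real m)" if s: "s \<in> {1..r}" for s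
  proof -
    let ?x = "2 * pi * real s / real m"
    have "pi * real s \<le> 4 * real r" using s pi by (intro mult_mono) auto
    then have "(pi * real s)\<^sup>2 \<le> (4 * real r)\<^sup>2" by (intro power_mono) auto
    then have "?x\<^sup>2 / 2 \<le> 2 * (4 * real r)\<^sup>2 / (real m)\<^sup>2"
      by (simp add: power_divide power_mult_distrib divide_right_mono)
    then show ?thesis using cos_ge_quadratic[of ?x] by (simp add: power_mult_distrib)
  qed
  then have "(\<Sum>s=1..r. 1 - 32 * (real r)\<^sup>2 / (real m)\<^sup>2) \<le> (\<Sum>s=1..r. cos (2 * pi * real s / real m))"
    by (rule sum_mono)
  then have "real r - 32 * real r ^ 3 / (real m)\<^sup>2 \<le> (\<Sum>s=1..r. cos (2 * pi * real s / real m))"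
    by (simp add: right_diff_distrib eval_nat_numeral mult_ac)
  then show ?thesis
    unfolding sum_residue_interval[OF assms] by simp
qed

text \<open>Multiplication by \<open>j\<close> permutes the residues, which reduces the claim to
  \<open>j = 1\<close>. There the interval is a superlevel set of the cosine, with threshold its
  value at \<open>r\<close>.\<close>

lemma sum_coprime_le_residue_interval:
  assumes T: "T \<subseteq> {0..<int m}" "card T = 2 * r + 1" and r: "2 * r < m" and j: "coprime j m"
  shows "(\<Sum>a\<in>T. Re (zm_char m j a)) \<le> (\<Sum>a\<in>residue_interval m r. Re (zm_char m 1 a))"
proof -
  have m: "m > 0" using r by simp
  let ?f = "\<lambda>a. (a * int j) mod int m"
  have inj: "inj_on ?f T"
  proof (rule inj_onI)
    fix x y assume xy: "x \<in> T" "y \<in> T" "?f x = ?f y"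
    then have "[x * int j = y * int j] (mod int m)" by (simp add: cong_def)
    then have "[x = y] (mod int m)"
      using j by (simp add: cong_mult_rcancel)
    then show "x = y" using xy T(1) by (metis atLeastLessThan_iff cong_def mod_pos_pos_trivial subset_iff)
  qed
  have "zm_char m j a = zm_char m 1 (?f a)" for a
    using m by (simp add: zm_char_mod) (simp add: zm_char_cis mult_ac)
  then have "(\<Sum>a\<in>T. Re (zm_char m j a)) = (\<Sum>b\<in>?f ` T. Re (zm_char m 1 b))"
    by (simp add: sum.reindex[OF inj])
  also have "\<dots> \<le> (\<Sum>a\<in>residue_interval m r. Re (zm_char m 1 a))"
  proof (rule sum_le_sum_superlevel[where A = "{0..<int m}" and c = "cos (2 * pi * real r / real m)"])
    show "?f ` T \<subseteq> {0..<int m}" using m by auto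
    show "residue_interval m r \<subseteq> {0..<int m}"
      using residue_interval(1)[OF r] by (simp add: symmetric_residues_def)
    show "card (?f ` T) = card (residue_interval m r)"
      using card_image[OF inj] T(2) residue_interval(3)[OF r] by simp
  next
    fix a assume "a \<in> residue_interval m r"
    then consider "0 \<le> a \<and> a \<le> int r" | "int m - int r \<le> a \<and> a < int m"
      by (auto simp: residue_interval_def)
    then show "cos (2 * pi * real r / real m) \<le> Re (zm_char m 1 a)"
    proof cases
      case 1
      then have "real_of_int a \<le> real r" "0 \<le> real_of_int a" by linarith+
      then have "cos (2 * pi * real r / real m) \<le> cos (2 * pi * of_int a / real m)"
        using r m by (intro cos_fraction_antimono) auto
      then show ?thesis by (simp add: Re_zm_char)
    next
      case 2
      then have *: "real_of_int (int m - a) \<le> real r" "0 \<le> real_of_int (int m - a)" by linarith+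
      then have "cos (2 * pi * real r / real m) \<le> cos (2 * pi * of_int (int m - a) / real m)"
        using r m by (intro cos_fraction_antimono) auto
      also have "2 * pi * of_int (int m - a) / real m = 2 * pi - 2 * pi * of_int a / real m"
        using m by (simp add: field_simps)
      finally show ?thesis by (simp add: Re_zm_char cos_diff)
    qed
  next
    fix a assume "a \<in> {0..<int m} - residue_interval m r"
    then have "int r \<le> a" "a \<le> int m - int r" by (auto simp: residue_interval_def)
    then have "real r \<le> of_int a" "of_int a \<le> real m - real r" by linarith+
    then have "cos (2 * pi * of_int a / real m) \<le> cos (2 * pi * real r / real m)"
      using r m by (intro cos_fraction_antimono) auto
    then show "Re (zm_char m 1 a) \<le> cos (2 * pi * real r / real m)" by (simp add: Re_zm_char)
  qed auto
  finally show ?thesis .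
qed

section \<open>Characters of prime order\<close>

text \<open>The character with index \<open>e * i\<close> factors through the residues modulo
  \<open>d\<close>.\<close>

lemma zm_char_mult_cancel:
  assumes "e > 0"
  shows "Re (zm_char (d * e) (e * i) a) = cos (2 * pi * of_int (a * int i) / real d)"
  using assms by (simp add: Re_zm_char mult_ac)

text \<open>A nonzero residue modulo \<open>d\<close> lies between \<open>1\<close> and
  \<open>d - 1\<close>, and the cosine is largest at these two ends.\<close>

lemma cos_fraction_le_of_not_dvd:
  assumes d: "d > 0" and n: "\<not> int d dvd n"
  shows "cos (2 * pi * of_int n / real d) \<le> cos (2 * pi / real d)"
proof -
  let ?b = "n mod int d"
  have b: "1 \<le> ?b" "?b \<le> int d - 1"
    using d n pos_mod_bound[of "int d" n] pos_mod_sign[of "int d" n]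
    unfolding dvd_eq_mod_eq_0 by linarith+
  have "cos (2 * pi * of_int n / real d) = cos (2 * pi * of_int ?b / real d)"
    using arg_cong[OF zm_char_mod[OF d, of 1 n], of Re] by (simp add: Re_zm_char)
  also have "\<dots> \<le> cos (2 * pi * 1 / real d)"
    using d b by (intro cos_fraction_antimono) (auto simp: algebra_simps simp flip: of_int_add)
  finally show ?thesis by simp
qed

lemma multiples_residues:
  assumes "d > 0" "e > 0"
  shows "{a \<in> {0..<int (d * e)}. int d dvd a} = (\<lambda>i. int d * i) ` {0..<int e}"
    and "card {a \<in> {0..<int (d * e)}. int d dvd a} = e"
proof -
  show *: "{a \<in> {0..<int (d * e)}. int d dvd a} = (\<lambda>i. int d * i) ` {0..<int e}"
    using assms by (auto simp: zero_le_mult_iff elim!: dvdE)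
  show "card {a \<in> {0..<int (d * e)}. int d dvd a} = e"
    unfolding * using assms by (subst card_image) (auto intro: inj_onI)
qed

text \<open>At most \<open>e\<close> elements of \<open>T\<close> are multiples of \<open>d\<close>,
  and each contributes at most \<open>1\<close>. For any other \<open>a\<close> the prime
  \<open>d\<close> does not divide \<open>a * i\<close>, so the contribution is at most
  \<open>cos (2 * pi / d)\<close>.\<close>

lemma sum_noncoprime_le:
  assumes d: "prime d" "e > 0" and i: "\<not> d dvd i"
    and T: "T \<subseteq> {0..<int (d * e)}"
  shows "(\<Sum>a\<in>T. Re (zm_char (d * e) (e * i) a))
    \<le> real (card T) - (real (card T) - real e) * (1 - cos (2 * pi / real d))"
proof -
  have d0: "d > 0" using d(1) by (simp add: prime_gt_0_nat)
  define c where "c = cos (2 * pi / real d)"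
  let ?f = "\<lambda>a. Re (zm_char (d * e) (e * i) a)"
  have c: "c \<le> 1" by (simp add: c_def)
  have fin: "finite T" using T finite_subset by blast
  define Z where "Z = {a \<in> T. int d dvd a}"
  have "card Z \<le> card {a \<in> {0..<int (d * e)}. int d dvd a}"
    using T by (intro card_mono finite_Collect_conjI disjI1) (auto simp: Z_def)
  then have cardZ: "card Z \<le> e" using multiples_residues(2)[OF d0 d(2)] by simp
  have "?f a \<le> c" if "a \<in> T - Z" for a
  proof -
    have "\<not> int d dvd a * int i"
      using that i d(1) by (auto simp: Z_def prime_dvd_mult_iff)
    then show ?thesis
      unfolding c_def zm_char_mult_cancel[OF d(2)] by (rule cos_fraction_le_of_not_dvd[OF d0])
  qed
  then have "(\<Sum>a\<in>T - Z. ?f a - c) \<le> 0" by (intro sum_nonpos) auto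
  moreover have "(\<Sum>a\<in>Z. ?f a - c) \<le> real (card Z) * (1 - c)"
    by (rule sum_bounded_above) (simp add: Re_zm_char)
  moreover have "real (card Z) * (1 - c) \<le> real e * (1 - c)"
    using cardZ c by (intro mult_right_mono) auto
  moreover have "(\<Sum>a\<in>T. ?f a - c) = (\<Sum>a\<in>T - Z. ?f a - c) + (\<Sum>a\<in>Z. ?f a - c)"
    by (rule sum.subset_diff) (use fin in \<open>auto simp: Z_def\<close>)
  ultimately have "(\<Sum>a\<in>T. ?f a) - real (card T) * c \<le> real e * (1 - c)"
    by (simp add: sum_subtractf)
  then show ?thesis by (simp add: c_def algebra_simps)
qed

text \<open>The quadratic term gives \<open>18 / d^2\<close> by \<open>pi >= 3\<close>, and the
  quartic term takes away at most \<open>(512 / 3) / d^4\<close>. This is at most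
  \<open>1 / d^2\<close> because \<open>14^2 = 196 >= 512 / 3\<close>.\<close>

lemma one_minus_cos_fraction_ge:
  assumes "d \<ge> 14"
  shows "17 / (real d)\<^sup>2 \<le> 1 - cos (2 * pi / real d)"
proof -
  let ?x = "2 * pi / real d"
  have pi: "3 \<le> pi" "pi \<le> 4" using pi_approx by auto
  have d: "real d \<ge> 14" using assms by simp
  then have d2: "(real d)\<^sup>2 \<ge> 14\<^sup>2" by (intro power_mono) auto
  have "3\<^sup>2 \<le> pi\<^sup>2" "pi ^ 4 \<le> 4 ^ 4" using pi by (intro power_mono; auto)+
  then have "?x\<^sup>2 / 2 \<ge> 18 / (real d)\<^sup>2" "?x ^ 4 / 24 \<le> (512 / 3) / real d ^ 4"
    using d by (simp_all add: power_divide power_mult_distrib divide_right_mono)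
  moreover have "(512 / 3) / real d ^ 4 \<le> 1 / (real d)\<^sup>2"
  proof -
    have "(512 / 3) * (real d)\<^sup>2 \<le> (real d)\<^sup>2 * (real d)\<^sup>2" using d2 by (intro mult_right_mono) auto
    then show ?thesis using d by (simp add: field_simps flip: power_add)
  qed
  moreover have "18 / (real d)\<^sup>2 = 17 / (real d)\<^sup>2 + 1 / (real d)\<^sup>2"
    by (simp add: add_divide_distrib [symmetric])
  ultimately show ?thesis using cos_le_quartic[of ?x] by linarith
qed

section \<open>Sets attaining the bound for characters of prime order\<close>

definition near_multiples :: "nat \<Rightarrow> nat \<Rightarrow> nat \<Rightarrow> int set" where
  "near_multiples p q n = {a \<in> {0..<int (p * q)}. int p dvd a}
     \<union> (\<lambda>i. 1 + int p * i) ` {0..<int n} \<union> (\<lambda>i. int (p * q) - (1 + int p * i)) ` {0..<int n}"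

text \<open>The three pieces have residues \<open>0\<close>, \<open>1\<close> and
  \<open>p - 1\<close> modulo \<open>p\<close>, distinct as \<open>p >= 3\<close>; the third is the
  negative of the second. The sum is the case of equality in \<open>sum_noncoprime_le\<close> with
  \<open>d = p\<close>, \<open>e = q\<close>, \<open>i = 1\<close>.\<close>

lemma near_multiples:
  assumes p: "p \<ge> 3" and q: "q > 0" and n: "n \<le> q"
  shows "symmetric_residues (p * q) (near_multiples p q n)" "0 \<in> near_multiples p q n"
    "card (near_multiples p q n) = q + 2 * n"
    "(\<Sum>a\<in>near_multiples p q n. Re (zm_char (p * q) q a)) = real q + 2 * real n * cos (2 * pi / real p)"
proof -
  define m where "m = p * q"
  define A where "A = {a \<in> {0..<int m}. int p dvd a}"
  define B where "B = (\<lambda>i. 1 + int p * i) ` {0..<int n}"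
  define C where "C = (\<lambda>i. int m - (1 + int p * i)) ` {0..<int n}"
  have N: "near_multiples p q n = A \<union> B \<union> C"
    by (simp add: near_multiples_def A_def B_def C_def m_def)
  have m: "m > 0" using p q by (simp add: m_def)
  have B1: "0 < b \<and> b < int m \<and> b mod int p = 1" if b: "b \<in> B" for b
  proof -
    obtain i where i: "0 \<le> i" "i < int n" "b = 1 + int p * i" using b by (auto simp: B_def)
    \<comment> \<open>Since \<open>i + 1 <= n <= q\<close>, the element \<open>1 + p * i\<close>
      stays below \<open>p * (i + 1) <= m\<close>.\<close>
    have "int p * (i + 1) \<le> int p * int q" using i n by (intro mult_left_mono) auto
    then have "b < int m" using p i by (simp add: m_def algebra_simps)
    moreover have "0 < b" using i by (simp add: add_pos_nonneg)
    moreover have "b mod int p = 1" using i p by simp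
    ultimately show ?thesis by blast
  qed
  have CB: "C = (\<lambda>b. int m - b) ` B" by (simp add: C_def B_def image_image)
  have C1: "0 < b \<and> b < int m \<and> b mod int p = int p - 1" if b: "b \<in> C" for b
  proof -
    obtain a where a: "a \<in> B" "b = int m - a" using b CB by auto
    have "b mod int p = (- a) mod int p" using a by (simp add: m_def mod_diff_eq [symmetric, of "int p * int q"] mod_minus_eq)
    also have "\<dots> = int p - 1" using B1[OF a(1)] p by (simp add: zmod_zminus1_eq_if)
    finally show ?thesis using B1[OF a(1)] a by simp
  qed
  have disj: "A \<inter> B = {}" "(A \<union> B) \<inter> C = {}"
    using B1 C1 p by (fastforce simp: A_def dvd_eq_mod_eq_0)+
  have "A \<subseteq> {0..<int m}" by (auto simp: A_def)
  then have fin: "finite A" "finite B" "finite C"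
    by (auto simp: B_def C_def intro: finite_subset)
  have cards: "card A = q" "card B = n" "card C = n"
  proof -
    show "card A = q" using multiples_residues(2)[of p q] p q by (simp add: A_def m_def)
    show "card B = n" unfolding B_def using p by (subst card_image) (auto intro: inj_onI)
    show "card C = n" unfolding C_def using p by (subst card_image) (auto intro: inj_onI)
  qed
  show "card (near_multiples p q n) = q + 2 * n"
    unfolding N using fin disj cards by (simp add: card_Un_disjoint)
  show "0 \<in> near_multiples p q n" using m by (simp add: N A_def)
  show "symmetric_residues (p * q) (near_multiples p q n)"
    unfolding symmetric_residues_def N m_def [symmetric]
  proof (intro conjI ballI)
    show "A \<union> B \<union> C \<subseteq> {0..<int m}" using B1 C1 by (force simp: A_def)
    fix a assume "a \<in> A \<union> B \<union> C"
    then consider "a \<in> A" | "a \<in> B" | "a \<in> C" by blast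
    then show "(- a) mod int m \<in> A \<union> B \<union> C"
    proof cases
      case 1
      have "int p dvd (- a) mod int m"
        using 1 by (intro dvd_mod) (auto simp: A_def m_def)
      then show ?thesis using m by (simp add: A_def)
    next
      case 2
      then show ?thesis using B1[OF 2] CB by (simp add: neg_mod_residue)
    next
      case 3
      then show ?thesis using C1[OF 3] CB by (auto simp: neg_mod_residue)
    qed
  qed
  let ?f = "\<lambda>a. Re (zm_char m q a)"
  have f: "?f a = cos (2 * pi * of_int a / real p)" for a
    using zm_char_mult_cancel[of q p 1 a] q by (simp add: m_def)
  have f_mod: "?f a = cos (2 * pi * of_int (a mod int p) / real p)" for a
    unfolding f using arg_cong[OF zm_char_mod[of p 1 a], of Re] p by (simp add: Re_zm_char)
  have "sum ?f A = real q"
    using sum.cong[of A A ?f "\<lambda>_. 1"] cards by (simp add: f_mod A_def dvd_eq_mod_eq_0)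
  moreover have "sum ?f B = real n * cos (2 * pi / real p)"
    using sum.cong[of B B ?f "\<lambda>_. cos (2 * pi / real p)"] cards B1 by (simp add: f_mod)
  moreover have "sum ?f C = real n * cos (2 * pi / real p)"
  proof -
    have "cos (2 * pi * of_int (int p - 1) / real p) = cos (2 * pi - 2 * pi / real p)"
      using p by (simp add: field_simps)
    then have "cos (2 * pi * of_int (int p - 1) / real p) = cos (2 * pi / real p)"
      by (simp add: cos_diff)
    then show ?thesis
      using sum.cong[of C C ?f "\<lambda>_. cos (2 * pi / real p)"] cards C1 by (simp add: f_mod)
  qed
  ultimately show "(\<Sum>a\<in>near_multiples p q n. Re (zm_char (p * q) q a)) = real q + 2 * real n * cos (2 * pi / real p)"
    unfolding N m_def [symmetric] using fin disj by (simp add: sum.union_disjoint)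
qed

section \<open>The bands of the set J\<close>

lemma le_two_sqrt: "x\<^sup>2 \<le> 4 * y \<Longrightarrow> x \<le> 2 * sqrt y"
proof -
  assume "x\<^sup>2 \<le> 4 * y"
  then have "x / 2 \<le> sqrt y" by (intro real_le_rsqrt) (simp add: power_divide)
  then show ?thesis by simp
qed

lemma two_sqrt_less: "0 < x \<Longrightarrow> 4 * y < x\<^sup>2 \<Longrightarrow> 2 * sqrt y < x"
proof -
  assume "0 < x" "4 * y < x\<^sup>2"
  then have "sqrt y < x / 2" by (intro real_less_lsqrt) (simp_all add: power_divide)
  then show ?thesis by simp
qed

text \<open>The triangle inequality suffices: \<open>(l + 2)^2 <= 4 * m\<close> is the same as
  \<open>l^2 <= 4 * (m - l - 1)\<close>.\<close>

lemma ramanujan_of_small_covalency: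
  assumes m: "m \<ge> 2" and S: "cayley_subset m S" and l: "(covalency m S + 2)\<^sup>2 \<le> 4 * m"
  shows "ramanujan m S"
  unfolding ramanujan_iff[OF m S]
proof
  fix j assume "j \<in> {1..m-1}"
  define T where "T = {0..<int m} - S"
  have "\<bar>\<Sum>a\<in>T. Re (zm_char m j a)\<bar> \<le> (\<Sum>a\<in>T. \<bar>Re (zm_char m j a)\<bar>)"
    by (rule sum_abs)
  also have "\<dots> \<le> real (card T) * 1"
    by (rule sum_bounded_above) (simp add: Re_zm_char)
  also have "\<dots> = real (covalency m S)"
    using cayley_subset_card_covalency(2)[OF _ S] m by (simp add: T_def)
  also have "\<dots> \<le> 2 * sqrt (real m - real (covalency m S) - 1)"
  proof (rule le_two_sqrt)
    have "real ((covalency m S + 2)\<^sup>2) \<le> real (4 * m)" using l of_nat_le_iff by blast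
    then show "(real (covalency m S))\<^sup>2 \<le> 4 * (real m - real (covalency m S) - 1)"
      by (simp add: power2_eq_square algebra_simps)
  qed
  finally show "\<bar>\<Sum>a\<in>{0..<int m} - S. Re (zm_char m j a)\<bar> \<le> 2 * sqrt (real m - real (covalency m S) - 1)"
    by (simp add: T_def)
qed

text \<open>The element \<open>0\<close> contributes \<open>1\<close> and every other at least
  \<open>-1\<close>. This handles the negative side of the absolute value in
  \<open>ramanujan_iff\<close>.\<close>

lemma sum_Re_zm_char_ge:
  assumes "finite T" "0 \<in> T"
  shows "(\<Sum>a\<in>T. Re (zm_char m j a)) \<ge> 2 - real (card T)"
proof -
  have "(\<Sum>a\<in>T - {0}. Re (zm_char m j a)) \<ge> (\<Sum>a\<in>T - {0}. - 1)"
    by (rule sum_mono) (simp add: Re_zm_char)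
  moreover have "real (card (T - {0})) = real (card T) - 1"
    using assms card_gt_0_iff[of T] by (auto simp: of_nat_diff Suc_leI)
  ultimately show ?thesis
    using sum.remove[OF assms, of "\<lambda>a. Re (zm_char m j a)"] by (simp add: Re_zm_char)
qed

lemma not_ramanujan_compl:
  assumes m: "m \<ge> 2" and T: "symmetric_residues m T" "0 \<in> T" "2 * card T < m"
    and j: "j \<in> {1..m-1}" and gt: "(\<Sum>a\<in>T. Re (zm_char m j a)) > 2 * sqrt (real m - real (card T) - 1)"
  shows "\<not> ramanujan m ({0..<int m} - T)"
proof -
  have m0: "m > 0" using m by simp
  have "{0..<int m} - ({0..<int m} - T) = T" using T(1) by (auto simp: symmetric_residues_def)
  then have "\<bar>\<Sum>a\<in>T. Re (zm_char m j a)\<bar> \<le> 2 * sqrt (real m - real (card T) - 1)"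
    if "ramanujan m ({0..<int m} - T)"
    using that j
    unfolding ramanujan_iff[OF m cayley_subset_compl(1)[OF m0 T]] cayley_subset_compl(2)[OF m0 T] by simp
  with gt show ?thesis by linarith
qed

text \<open>For \<open>k \<ge> 4\<close> a number \<open>m\<close> in band \<open>k\<close> has \<open>k = \<lfloor>sqrt m - 3 / 2\<rfloor>\<close>; up to finitely many elements and
  parity, \<open>J\<close> is the union of these bands.\<close>

definition in_band :: "nat \<Rightarrow> nat \<Rightarrow> bool" where
  "in_band k m \<longleftrightarrow> k\<^sup>2 + 5 * k \<le> m + 5 \<and> m \<le> k\<^sup>2 + 5 * k + 5"

lemma in_band_real:
  assumes "in_band k m"
  shows "(real k)\<^sup>2 + 5 * real k - 5 \<le> real m" "real m \<le> (real k)\<^sup>2 + 5 * real k + 5"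
proof -
  have "real (k\<^sup>2 + 5 * k) \<le> real (m + 5)" "real m \<le> real (k\<^sup>2 + 5 * k + 5)"
    using assms of_nat_le_iff unfolding in_band_def by blast+
  then show "(real k)\<^sup>2 + 5 * real k - 5 \<le> real m" "real m \<le> (real k)\<^sup>2 + 5 * real k + 5" by simp_all
qed

lemma in_band_sqrt_bounds:
  assumes "in_band k m" "k \<ge> 1"
  shows "(real k)\<^sup>2 \<le> real m" "real m \<le> (real k + 5 / 2)\<^sup>2"
proof -
  have "(real k + 5 / 2)\<^sup>2 = (real k)\<^sup>2 + 5 * real k + 25 / 4"
    by (simp add: power2_eq_square algebra_simps)
  moreover have "real k \<ge> 1" using assms(2) by simp
  ultimately show "(real k)\<^sup>2 \<le> real m" "real m \<le> (real k + 5 / 2)\<^sup>2"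
    using in_band_real[OF assms(1)] by linarith+
qed

text \<open>The lower bound compares \<open>(k + 3/2)^2 = k^2 + 3*k + 9/4\<close> with
  \<open>k^2 + 5*k - 5\<close>, which is where \<open>k >= 4\<close> enters. The upper bound holds
  since \<open>(k + 5/2)^2\<close> exceeds \<open>k^2 + 5*k\<close> by
  \<open>25/4 > 5\<close>.\<close>

lemma l_zero_in_band:
  assumes "in_band k m" "k \<ge> 4"
  shows "l_zero m = 2 * int k + 1"
proof -
  have k: "real k \<ge> 4" using assms(2) by simp
  have "real k + 3 / 2 \<le> sqrt (real m)"
    using in_band_real[OF assms(1)] k by (intro real_le_rsqrt) (simp add: power2_eq_square algebra_simps)
  moreover have "sqrt (real m) < real k + 5 / 2"
    using in_band_real[OF assms(1)] k by (intro real_less_lsqrt) (simp_all add: power2_eq_square algebra_simps)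
  ultimately have "\<lfloor>sqrt (real m) - 3 / 2\<rfloor> = int k"
    by (intro floor_unique) auto
  then show ?thesis by (simp add: l_zero_def)
qed

text \<open>The second bound lets \<open>cayley_subset_compl\<close> apply to every complement of
  size at most \<open>2 * k + 5\<close>.\<close>

lemma in_band_large:
  assumes "in_band k m" "k \<ge> 1000"
  shows "m \<ge> 15" "2 * (2 * k + 5) < m"
proof -
  have "1000 * k \<le> k\<^sup>2" using assms(2) by (simp add: power2_eq_square)
  moreover have "k\<^sup>2 + 5 * k \<le> m + 5" using assms(1) by (simp add: in_band_def)
  ultimately show "m \<ge> 15" "2 * (2 * k + 5) < m" using assms(2) by auto
qed

lemma ramanujan_below_band:
  assumes "in_band k m" "k \<ge> 1000" "cayley_subset m S" "covalency m S \<le> 2 * k + 1"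
  shows "ramanujan m S"
proof (rule ramanujan_of_small_covalency[OF _ assms(3)])
  show "m \<ge> 2" using in_band_large[OF assms(1,2)] by simp
  have "(covalency m S + 2)\<^sup>2 \<le> (2 * k + 3)\<^sup>2" using assms(4) by (intro power_mono) auto
  also have "\<dots> = 4 * k\<^sup>2 + 12 * k + 9" by (simp add: power2_eq_square algebra_simps)
  also have "\<dots> \<le> 4 * m" using assms(1,2) unfolding in_band_def by linarith
  finally show "(covalency m S + 2)\<^sup>2 \<le> 4 * m" .
qed

lemma ex_cayley_subset_covalency:
  assumes "in_band k m" "k \<ge> 1000" "r \<le> k + 2"
  shows "\<exists>S. cayley_subset m S \<and> covalency m S = 2 * r + 1"
proof -
  have m: "m > 0" and r: "2 * r < m" "2 * (2 * r + 1) < m" using in_band_large[OF assms(1,2)] assms(3) by auto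
  then show ?thesis
    using cayley_subset_compl[OF m residue_interval(1,2)[OF r(1)]] residue_interval(3)[OF r(1)] by metis
qed

text \<open>The interval of \<open>2 * k + 5\<close> residues loses at most \<open>1\<close>,
  whereas the squared Ramanujan bound is at most
  \<open>4*k^2 + 12*k - 4 < (2*k + 4)^2\<close>.\<close>

lemma ex_not_ramanujan_above_band:
  assumes "in_band k m" "k \<ge> 1000"
  shows "\<exists>S. cayley_subset m S \<and> covalency m S = 2 * k + 5 \<and> \<not> ramanujan m S"
proof -
  define I where "I = residue_interval m (k + 2)"
  have m: "m > 0" "m \<ge> 2" and r: "2 * (k + 2) < m" "2 * (2 * k + 5) < m"
    using in_band_large[OF assms] by auto
  have cI: "card I = 2 * k + 5" using residue_interval(3)[OF r(1)] by (simp add: I_def)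
  have I: "symmetric_residues m I" "0 \<in> I" "2 * card I < m"
    using residue_interval(1,2)[OF r(1)] r(2) cI by (simp_all only: I_def)
  have k: "real k \<ge> 1000" using assms(2) by simp
  have "64 * (real k + 2) ^ 3 \<le> 64 * (2 * real k) ^ 3" using k by (intro mult_left_mono power_mono) auto
  also have "\<dots> = 512 * real k ^ 3" by (simp add: power_mult_distrib)
  also have "\<dots> \<le> real k * real k ^ 3" using k by (intro mult_right_mono) auto
  also have "\<dots> = ((real k)\<^sup>2)\<^sup>2" by (simp add: eval_nat_numeral)
  also have "\<dots> \<le> (real m)\<^sup>2" using in_band_sqrt_bounds[OF assms(1)] k by (intro power_mono) auto
  finally have "64 * (real k + 2) ^ 3 / (real m)\<^sup>2 \<le> 1" using m by simp
  then have ge: "(\<Sum>a\<in>I. Re (zm_char m 1 a)) \<ge> 2 * real k + 4"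
    using residue_interval_sum_ge[OF r(1)] by (simp add: I_def add.commute)
  have "2 * sqrt (real m - real (card I) - 1) < 2 * real k + 4"
    using in_band_real[OF assms(1)] k
    by (intro two_sqrt_less) (simp_all add: cI power2_eq_square algebra_simps)
  then have "\<not> ramanujan m ({0..<int m} - I)"
    using ge m by (intro not_ramanujan_compl[OF m(2) I, of 1]) auto
  then show ?thesis using cayley_subset_compl[OF m(1) I] cI by metis
qed

section \<open>The critical covalency \<open>2 * k + 3\<close>\<close>

text \<open>\<open>2 \<pi>\<^sup>2 / 3 > 6\<close> makes the loss of a \<open>(2 k + 3)\<close>-term cosine sum about \<open>12 / k\<close>, while the
  Ramanujan bound falls short of \<open>2 k + 3\<close> by at most about \<open>45 / (4 k)\<close>.\<close>

lemma eventually_interval_loss: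
  "\<forall>\<^sub>F k :: nat in sequentially. 23 / 2 / real k \<le>
     6 * (real k + 1) * (real k + 2) * (2 * real k + 3) / (real k + 5 / 2) ^ 4 - 342 * (real k + 1) ^ 5 / real k ^ 8"
  by real_asymp

text \<open>The rate \<open>23/2\<close> is chosen between \<open>45/4\<close>, the largest
  shortfall of the Ramanujan bound, and \<open>12\<close>, the guaranteed loss. In
  \<open>loss\<close>, \<open>m\<close> is replaced by its upper bound \<open>(k + 5/2)^2\<close> in
  the main term and by its lower bound \<open>k^2\<close> in the error term.\<close>

lemma interval_sum_le_band:
  assumes band: "in_band k m" "k \<ge> 1000"
    and loss: "23 / 2 / real k \<le>
     6 * (real k + 1) * (real k + 2) * (2 * real k + 3) / (real k + 5 / 2) ^ 4 - 342 * (real k + 1) ^ 5 / real k ^ 8"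
  shows "(\<Sum>a\<in>residue_interval m (k + 1). Re (zm_char m 1 a)) \<le> 2 * real k + 3 - 23 / 2 / real k"
proof -
  have r: "2 * (k + 1) < m" using in_band_large[OF band] by auto
  have m: "real m > 0" "real k > 0" using r band by auto
  have b: "(real k)\<^sup>2 \<le> real m" "real m \<le> (real k + 5 / 2)\<^sup>2"
    using in_band_sqrt_bounds[OF band(1)] band(2) by auto
  have "(real m)\<^sup>2 \<le> ((real k + 5 / 2)\<^sup>2)\<^sup>2" using b by (intro power_mono) auto
  then have 1: "6 * (real k + 1) * (real k + 2) * (2 * real k + 3) / (real k + 5 / 2) ^ 4
      \<le> 6 * (real k + 1) * (real k + 2) * (2 * real k + 3) / (real m)\<^sup>2"
    using m by (intro divide_left_mono) auto
  have "((real k)\<^sup>2) ^ 4 \<le> real m ^ 4" using b by (intro power_mono) auto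
  then have 2: "342 * (real k + 1) ^ 5 / real m ^ 4 \<le> 342 * (real k + 1) ^ 5 / real k ^ 8"
    using m by (intro divide_left_mono) auto
  have "(\<Sum>a\<in>residue_interval m (k + 1). Re (zm_char m 1 a))
    \<le> 2 * real k + 3 - 6 * (real k + 1) * (real k + 2) * (2 * real k + 3) / (real m)\<^sup>2 + 342 * (real k + 1) ^ 5 / real m ^ 4"
    using residue_interval_sum_le[OF r] by (simp add: add_ac)
  with 1 2 loss show ?thesis by linarith
qed

text \<open>To leading order \<open>2*k + 3 - e\<close> is at least \<open>(9/10) * k\<close> and
  \<open>d^2\<close> at most \<open>(121/100) * k^2\<close>. The claim thus rests on
  \<open>(9/10) * 17 = 15.3 > 13.915 = (23/2) * (121/100)\<close>, and this gap absorbs the lower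
  terms once \<open>k >= 1000\<close>.\<close>

lemma noncoprime_loss:
  fixes k d e :: real
  assumes k: "k \<ge> 1000" and d: "0 < d" "d \<le> 11 / 10 * (k + 5 / 2)" and e: "e \<le> 11 / 10 * (k + 5 / 2)"
  shows "23 / 2 / k \<le> (2 * k + 3 - e) * (17 / d\<^sup>2)"
proof -
  have d2: "d\<^sup>2 \<le> (11 / 10 * (k + 5 / 2))\<^sup>2" using d by (intro power_mono) auto
  have "23 / 2 * (11 / 10 * (k + 5 / 2))\<^sup>2 \<le> 9 / 10 * 17 * k\<^sup>2"
  proof -
    have "1000 * k \<le> k * k" using k by (intro mult_right_mono) auto
    moreover have "23 / 2 * (11 / 10 * (k + 5 / 2))\<^sup>2 = 2783 / 200 * (k * k) + 2783 / 40 * k + 2783 / 32"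
      by (simp add: power2_eq_square algebra_simps)
    ultimately show ?thesis using k unfolding power2_eq_square by linarith
  qed
  then have "23 / 2 * d\<^sup>2 \<le> 9 / 10 * 17 * k\<^sup>2" using d2 by linarith
  then have "23 / 2 / k \<le> 9 / 10 * k * (17 / d\<^sup>2)"
    using k d by (simp add: field_simps power2_eq_square)
  also have "\<dots> \<le> (2 * k + 3 - e) * (17 / d\<^sup>2)"
    using e by (intro mult_right_mono) auto
  finally show ?thesis .
qed

lemma noncoprime_sum_le_band:
  assumes k: "k \<ge> 1000"
    and d: "prime d" "e > 0" "real d \<le> 11 / 10 * (real k + 5 / 2)" "real e \<le> 11 / 10 * (real k + 5 / 2)" "d \<ge> 14"
    and i: "\<not> d dvd i" and T: "T \<subseteq> {0..<int (d * e)}" "card T = 2 * k + 3"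
  shows "(\<Sum>a\<in>T. Re (zm_char (d * e) (e * i) a)) \<le> 2 * real k + 3 - 23 / 2 / real k"
proof -
  have "23 / 2 / real k \<le> (2 * real k + 3 - real e) * (17 / (real d)\<^sup>2)"
    using k d by (intro noncoprime_loss) auto
  also have "\<dots> \<le> (2 * real k + 3 - real e) * (1 - cos (2 * pi / real d))"
    using d(4) k one_minus_cos_fraction_ge[OF d(5)] by (intro mult_left_mono) auto
  finally show ?thesis
    using sum_noncoprime_le[OF d(1,2) i T(1)] T(2) by simp
qed

text \<open>From \<open>q^2 = (q / p) * m\<close> both primes are at most \<open>11/10\<close> times
  \<open>sqrt m\<close>. Hence each character, of order \<open>m\<close>, \<open>p\<close> or
  \<open>q\<close>, loses at least \<open>23 / (2 * k)\<close>, more than the Ramanujan bound falls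
  short.\<close>

lemma ramanujan_at_band:
  assumes band: "in_band k m" "k \<ge> 1000"
    and loss: "23 / 2 / real k \<le>
     6 * (real k + 1) * (real k + 2) * (2 * real k + 3) / (real k + 5 / 2) ^ 4 - 342 * (real k + 1) ^ 5 / real k ^ 8"
    and pq: "m = p * q" "prime p" "prime q" "p < q" "real q < (11 / 10)\<^sup>2 * real p"
    and S: "cayley_subset m S" "covalency m S = 2 * k + 3"
  shows "ramanujan m S"
proof -
  have m: "m > 0" "m \<ge> 2" using in_band_large[OF band] by auto
  have k: "real k \<ge> 1000" using band(2) by simp
  have b: "(real k)\<^sup>2 \<le> real m" "real m \<le> (real k + 5 / 2)\<^sup>2"
    using in_band_sqrt_bounds[OF band(1)] band(2) by auto
  have pos: "real p > 0" "real q > 0" "p > 0" "q > 0" using pq by (auto simp: prime_gt_0_nat)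
  have "(real q)\<^sup>2 \<le> (11 / 10)\<^sup>2 * real p * real q"
    using pq(5) pos by (simp add: power2_eq_square)
  also have "\<dots> \<le> (11 / 10)\<^sup>2 * (real k + 5 / 2)\<^sup>2" using b pq(1) by simp
  finally have "(real q)\<^sup>2 \<le> (11 / 10 * (real k + 5 / 2))\<^sup>2" by (simp only: power_mult_distrib)
  then have q_le: "real q \<le> 11 / 10 * (real k + 5 / 2)" by (rule power2_le_imp_le) simp
  then have p_le: "real p \<le> 11 / 10 * (real k + 5 / 2)" using pq(4) by simp
  \<comment> \<open>Otherwise \<open>q < 2 * p\<close> gives \<open>m <= 14 * 28\<close>, against
    \<open>m >= 1000^2\<close>.\<close>
  have "p \<ge> 14"
  proof (rule ccontr)
    assume "\<not> p \<ge> 14"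
    then have "real p \<le> 14" "real q \<le> 14 * 2" using pq(5) by (auto simp: power2_eq_square)
    then have "real p * real q \<le> 14 * (14 * 2)" by (intro mult_mono) auto
    moreover have "1000\<^sup>2 \<le> (real k)\<^sup>2" using k by (intro power_mono) auto
    ultimately show False using b pq(1) by simp
  qed
  define T where "T = {0..<int m} - S"
  have cT: "card T = 2 * k + 3"
    using cayley_subset_card_covalency(2)[OF m(1) S(1)] S(2) by (simp add: T_def)
  have T: "T \<subseteq> {0..<int m}" "finite T" "0 \<in> T"
    using S(1) m by (auto simp: T_def cayley_subset_def)
  have upper: "(\<Sum>a\<in>T. Re (zm_char m j a)) \<le> 2 * real k + 3 - 23 / 2 / real k"
    if j: "j \<in> {1..m-1}" for j
  proof -
    have not_dvd: "\<not> m dvd j" using j by (auto dest!: dvd_imp_le)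
    consider "p dvd j" | "q dvd j" | "coprime j p" "coprime j q"
      using pq(2,3) prime_imp_coprime coprime_commute by metis
    then show ?thesis
    proof cases
      \<comment> \<open>A multiple of \<open>p\<close> as index gives a character of order
        \<open>q\<close>, so the roles are \<open>d = q\<close> and \<open>e = p\<close>.\<close>
      case 1
      then obtain i where i: "j = p * i" ..
      have "\<not> q dvd i" using not_dvd j i pq(1) by (metis mult_dvd_mono dvd_refl)
      then show ?thesis
        using noncoprime_sum_le_band[of k q p i T] band pq T(1) cT q_le p_le pos \<open>p \<ge> 14\<close> i
        by (simp add: mult.commute)
    next
      case 2
      then obtain i where i: "j = q * i" ..
      have "\<not> p dvd i" using not_dvd j i pq(1) by (metis mult_dvd_mono dvd_refl mult.commute)
      then show ?thesis
        using noncoprime_sum_le_band[of k p q i T] band pq T(1) cT q_le p_le pos \<open>p \<ge> 14\<close> i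
        by simp
    next
      case 3
      then have "coprime j m" using pq(1) by simp
      moreover have "2 * (k + 1) < m" using in_band_large[OF band] by simp
      ultimately show ?thesis
        using sum_coprime_le_residue_interval[OF T(1), of "k + 1" j] cT interval_sum_le_band[OF band loss]
        by simp
    qed
  qed
  have small: "23 / 2 / real k \<le> 1 / 2" using k by (simp add: field_simps)
  \<comment> \<open>With \<open>x = 23 / (2 * k)\<close> the square on the left is at most
    \<open>4*k^2 + 12*k + 9 - 46 + 1\<close>. This equals \<open>4 * (m - (2*k + 3) - 1)\<close> at
    the lower end \<open>m = k^2 + 5*k - 5\<close> of the band.\<close>
  have bound: "2 * real k + 3 - 23 / 2 / real k \<le> 2 * sqrt (real m - real (2 * k + 3) - 1)"
  proof (rule le_two_sqrt)
    define x where "x = 23 / 2 / real k"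
    have x: "x * real k = 23 / 2" "0 \<le> x" "x \<le> 1 / 2" using k small by (simp_all add: x_def)
    then have "x * x \<le> 1 * 1" by (intro mult_mono) auto
    moreover have "(2 * real k + 3 - x)\<^sup>2 = 4 * (real k)\<^sup>2 + 12 * real k + 9 - 4 * (x * real k) - 6 * x + x * x"
      by (simp add: power2_eq_square algebra_simps)
    ultimately have "(2 * real k + 3 - x)\<^sup>2 \<le> 4 * (real k)\<^sup>2 + 12 * real k - 36" using x by simp
    then show "(2 * real k + 3 - 23 / 2 / real k)\<^sup>2 \<le> 4 * (real m - real (2 * k + 3) - 1)"
      using in_band_real(1)[OF band(1)] by (simp add: x_def)
  qed
  show ?thesis
    unfolding ramanujan_iff[OF m(2) S(1)] S(2) T_def [symmetric]
  proof
    fix j assume j: "j \<in> {1..m-1}"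
    \<comment> \<open>The sum is at least \<open>-(2*k + 1)\<close>, and \<open>2*k + 1\<close> is
      below the bound just shown because \<open>23 / (2*k) <= 1/2\<close>.\<close>
    have "(\<Sum>a\<in>T. Re (zm_char m j a)) \<ge> 2 - real (2 * k + 3)"
      using sum_Re_zm_char_ge[OF T(2,3), of m j] by (simp add: cT)
    then show "\<bar>\<Sum>a\<in>T. Re (zm_char m j a)\<bar> \<le> 2 * sqrt (real m - real (2 * k + 3) - 1)"
      using upper[OF j] small bound by (simp add: abs_le_iff)
  qed
qed

text \<open>The complement is \<open>near_multiples p q n\<close> with
  \<open>q + 2 * n = 2 * k + 3\<close>. The upper bound on \<open>q / p\<close> makes the multiples
  of \<open>p\<close> fit, and the lower bound makes \<open>n\<close> small, so little is
  lost.\<close>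

lemma ex_not_ramanujan_at_band:
  assumes band: "in_band k m" "k \<ge> 1000"
    and pq: "m = p * q" "odd q" "3 \<le> p" "q < 4 * p" "(399 / 200)\<^sup>2 * real p < real q"
  shows "\<exists>S. cayley_subset m S \<and> covalency m S = 2 * k + 3 \<and> \<not> ramanujan m S"
proof -
  have m: "m > 0" "m \<ge> 2" using in_band_large[OF band] by auto
  have k: "real k \<ge> 1000" using band(2) by simp
  have b: "(real k)\<^sup>2 \<le> real m" "real m \<le> (real k + 5 / 2)\<^sup>2"
    using in_band_sqrt_bounds[OF band(1)] band(2) by auto
  have q0: "q > 0" using pq(2) by (simp add: odd_pos)
  have "(real q)\<^sup>2 < 4 * real p * real q"
    using pq(4) q0 by (simp add: power2_eq_square)
  also have "\<dots> \<le> 4 * (real k + 5 / 2)\<^sup>2" using b pq(1) by simp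
  also have "\<dots> = (2 * real k + 5)\<^sup>2" by (simp add: power2_eq_square algebra_simps)
  finally have "real q < 2 * real k + 5" by (rule power_less_imp_less_base) simp
  then have "q < 2 * k + 5" by linarith
  \<comment> \<open>Oddness of \<open>q\<close> excludes \<open>2 * k + 4\<close> and makes the
    remainder to \<open>2 * k + 3\<close> even.\<close>
  with pq(2) have "q \<le> 2 * k + 3" by presburger
  moreover from this pq(2) have "even (2 * k + 3 - q)" by simp
  then obtain n where "2 * k + 3 - q = 2 * n" ..
  ultimately have n: "2 * k + 3 = q + 2 * n" by linarith
  have "(399 / 200 * real k)\<^sup>2 \<le> (399 / 200)\<^sup>2 * (real p * real q)"
    unfolding power_mult_distrib using b(1) pq(1) by (intro mult_left_mono) auto
  also have "\<dots> \<le> (real q)\<^sup>2"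
    using mult_right_mono[OF less_imp_le[OF pq(5)], of "real q"] by (simp add: power2_eq_square)
  finally have q_ge: "399 / 200 * real k \<le> real q" by (rule power2_le_imp_le) simp
  then have nq: "n \<le> q" using n k by linarith
  have "(real k)\<^sup>2 \<le> real p * real q" using b pq(1) by simp
  also have "\<dots> \<le> real p * (4 * real p)" using pq(4) by (intro mult_left_mono) auto
  finally have p2: "(real k)\<^sup>2 / 4 \<le> (real p)\<^sup>2" by (simp add: power2_eq_square)
  define T where "T = near_multiples p q n"
  have cT: "card T = 2 * k + 3" using near_multiples(3)[OF pq(3) q0 nq] n by (simp add: T_def)
  have T: "symmetric_residues m T" "0 \<in> T" "2 * card T < m"
    using near_multiples(1,2)[OF pq(3) q0 nq] in_band_large[OF band] cT by (simp_all only: T_def pq(1)) simp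
  have "(2 * pi / real p)\<^sup>2 / 2 \<le> 128 / (real k)\<^sup>2"
  proof -
    have "pi\<^sup>2 \<le> 4\<^sup>2" using pi_less_4 by (intro power_mono) auto
    then have "(2 * pi / real p)\<^sup>2 / 2 \<le> 32 / (real p)\<^sup>2"
      by (simp add: power_divide power_mult_distrib divide_right_mono)
    also have "\<dots> \<le> 32 / ((real k)\<^sup>2 / 4)" using p2 k pq(3) by (intro divide_left_mono) auto
    finally show ?thesis by simp
  qed
  then have "1 - cos (2 * pi / real p) \<le> 128 / (real k)\<^sup>2"
    using cos_ge_quadratic[of "2 * pi / real p"] by linarith
  then have "2 * real n * (1 - cos (2 * pi / real p)) \<le> 2 * real n * (128 / (real k)\<^sup>2)"
    by (intro mult_left_mono) auto
  \<comment> \<open>Here \<open>2 * n = 2*k + 3 - q\<close> and \<open>q >= (399/200) * k\<close>.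
    The product is \<open>(16/25) / k + 384 / k^2\<close>, below \<open>(6/5) / k\<close> as
    \<open>k >= 1000\<close>.\<close>
  also have "\<dots> \<le> (real k / 200 + 3) * (128 / (real k)\<^sup>2)"
    using n q_ge by (intro mult_right_mono) (auto simp: algebra_simps)
  also have "\<dots> \<le> 6 / 5 / real k" using k by (simp add: field_simps power2_eq_square)
  finally have ge: "(\<Sum>a\<in>T. Re (zm_char m q a)) \<ge> 2 * real k + 3 - 6 / 5 / real k"
    using near_multiples(4)[OF pq(3) q0 nq] n by (simp add: T_def pq(1) algebra_simps)
  \<comment> \<open>The rate \<open>6/5\<close> must stay below \<open>5/4\<close>: squaring
    subtracts \<open>24/5 < 5\<close> from the constant \<open>9\<close>, and the right side must
    exceed \<open>4*k^2 + 12*k + 4\<close>, attained at the upper end of the band.\<close>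
  have "2 * sqrt (real m - real (card T) - 1) < 2 * real k + 3 - 6 / 5 / real k"
  proof (rule two_sqrt_less)
    have "6 / 5 / real k \<le> 1" using k by (simp add: field_simps)
    then show "0 < 2 * real k + 3 - 6 / 5 / real k" using k by linarith
    have "(2 * real k + 3 - 6 / 5 / real k)\<^sup>2
        = (2 * real k + 3)\<^sup>2 - 24 / 5 - 36 / 5 / real k + (6 / 5 / real k)\<^sup>2"
      using k by (simp add: power2_eq_square field_simps)
    moreover have "36 / 5 / real k \<le> 1 / 10" using k by (simp add: field_simps)
    moreover have "(6 / 5 / real k)\<^sup>2 \<ge> 0" by simp
    moreover have "(2 * real k + 3)\<^sup>2 = 4 * (real k)\<^sup>2 + 12 * real k + 9" by (simp add: power2_eq_square algebra_simps)
    moreover have "4 * (real m - real (card T) - 1) \<le> 4 * (real k)\<^sup>2 + 12 * real k + 4"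
      using in_band_real(2)[OF band(1)] by (simp add: cT)
    ultimately show "4 * (real m - real (card T) - 1) < (2 * real k + 3 - 6 / 5 / real k)\<^sup>2"
      by linarith
  qed
  moreover have "q \<in> {1..m-1}"
  proof -
    have "q * 2 \<le> m" using pq(1,3) by (simp add: mult.commute)
    then show ?thesis using q0 by auto
  qed
  ultimately have "\<not> ramanujan m ({0..<int m} - T)"
    using ge by (intro not_ramanujan_compl[OF m(2) T, of q]) auto
  then show ?thesis using cayley_subset_compl[OF m(1) T] cT by metis
qed

section \<open>From membership in \<open>J_set\<close> to the value of \<open>l_hat\<close>\<close>

text \<open>The summand \<open>29\<close> discards the sporadic values
  \<open>2 * n + 1 <= 29\<close>. It also forces \<open>k >= K\<close>, as bands with smaller index
  end by \<open>K^2 + 5*K + 5\<close>.\<close>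

lemma J_set_in_band:
  assumes "int m \<in> J_set" "m > K\<^sup>2 + 5 * K + 29"
  shows "\<exists>k\<ge>K. in_band k m"
proof -
  have "\<exists>k :: int. k \<ge> 4 \<and> k\<^sup>2 + 5 * k - 5 \<le> int m \<and> int m \<le> k\<^sup>2 + 5 * k + 5"
    using assms(1) unfolding J_set_def Un_iff mem_Collect_eq
  proof (elim disjE exE conjE)
    fix n :: int assume "int m = 2 * n + 1" "n \<le> 14"
    then show ?thesis using assms(2) by linarith
  next
    fix k c :: int assume "int m = k\<^sup>2 + 5 * k + c" "4 \<le> k" "c \<in> {1, -1, 3, -3, 5}"
    then show ?thesis by (intro exI[of _ k]) auto
  next
    fix k :: int assume "int m = k\<^sup>2 + 5 * k - 5" "19 \<le> k"
    then show ?thesis by (intro exI[of _ k]) auto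
  qed
  then obtain k :: int where k: "k \<ge> 4" "k\<^sup>2 + 5 * k - 5 \<le> int m" "int m \<le> k\<^sup>2 + 5 * k + 5"
    by blast
  obtain k' where k': "k = int k'" using k(1) zero_le_imp_eq_int[of k] by auto
  have "int (k'\<^sup>2 + 5 * k') \<le> int (m + 5)" "int m \<le> int (k'\<^sup>2 + 5 * k' + 5)"
    using k k' by simp_all
  then have "in_band k' m" unfolding in_band_def using of_nat_le_iff by blast
  moreover have "K \<le> k'"
  proof (rule ccontr)
    assume "\<not> K \<le> k'"
    then have "k'\<^sup>2 \<le> K\<^sup>2" "k' \<le> K" by (auto intro: power_mono)
    with \<open>in_band k' m\<close> assms(2) show False unfolding in_band_def by linarith
  qed
  ultimately show ?thesis by blast
qed

theorem theorem4p8: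
  "\<exists>\<xi>\<^sub>1 \<xi>\<^sub>2 :: real. 1 < \<xi>\<^sub>1 \<and> \<xi>\<^sub>1 < \<xi>\<^sub>2 \<and> \<xi>\<^sub>2 < 4 \<and>
     (\<forall>\<^sub>F m :: nat in sequentially. \<forall>p q :: nat.
        m = p * q \<and> int m \<in> J_set \<and> prime p \<and> odd p \<and> prime q \<and> odd q \<and> p < q \<and> q < 4 * p \<longrightarrow>
          (1 < real q / real p \<and> real q / real p < \<xi>\<^sub>1 \<longrightarrow> exceptional m) \<and>
          (\<xi>\<^sub>2 < real q / real p \<and> real q / real p < 4 \<longrightarrow> ordinary m))"
proof (intro exI conjI)
  obtain N where N: "\<And>k. k \<ge> N \<Longrightarrow> 23 / 2 / real k \<le>
     6 * (real k + 1) * (real k + 2) * (2 * real k + 3) / (real k + 5 / 2) ^ 4 - 342 * (real k + 1) ^ 5 / real k ^ 8"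
    using eventually_interval_loss unfolding eventually_sequentially by blast
  define K where "K = max N 1000"
  \<comment> \<open>The witnesses are \<open>(11/10)^2\<close> and \<open>(399/200)^2\<close>,
    squares so that comparing \<open>q\<close> with \<open>sqrt m\<close> yields rational
    factors.\<close>
  have "\<forall>m > K\<^sup>2 + 5 * K + 29. \<forall>p q :: nat.
        m = p * q \<and> int m \<in> J_set \<and> prime p \<and> odd p \<and> prime q \<and> odd q \<and> p < q \<and> q < 4 * p \<longrightarrow>
          (1 < real q / real p \<and> real q / real p < (11 / 10)\<^sup>2 \<longrightarrow> exceptional m) \<and>
          ((399 / 200)\<^sup>2 < real q / real p \<and> real q / real p < 4 \<longrightarrow> ordinary m)"
  proof (intro allI impI)
    fix m p q :: nat
    assume large: "m > K\<^sup>2 + 5 * K + 29"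
      and "m = p * q \<and> int m \<in> J_set \<and> prime p \<and> odd p \<and> prime q \<and> odd q \<and> p < q \<and> q < 4 * p"
    then have pq: "m = p * q" "int m \<in> J_set" "prime p" "odd p" "prime q" "odd q" "p < q" "q < 4 * p"
      by auto
    obtain k where k: "k \<ge> K" and band: "in_band k m"
      using J_set_in_band[OF pq(2) large] by blast
    have k1000: "k \<ge> 1000" and kN: "k \<ge> N" using k by (auto simp: K_def)
    have odd: "odd m" using pq by simp
    have m15: "m \<ge> 15" using in_band_large[OF band k1000] by simp
    have l0: "l_zero m = 2 * int k + 1" using l_zero_in_band[OF band] k1000 by simp
    have p0: "real p > 0" using pq(3) by (simp add: prime_gt_0_nat)
    have p3: "p \<ge> 3" using pq(3,4) prime_ge_2_nat[of p] by (cases "p = 2") auto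
    have ex: "\<exists>S. cayley_subset m S \<and> covalency m S = 2 * k + 1"
      "\<exists>S. cayley_subset m S \<and> covalency m S = 2 * k + 3"
      using ex_cayley_subset_covalency[OF band k1000, of k] ex_cayley_subset_covalency[OF band k1000, of "k + 1"]
      by (auto simp: numeral_3_eq_3)
    show "(1 < real q / real p \<and> real q / real p < (11 / 10)\<^sup>2 \<longrightarrow> exceptional m) \<and>
          ((399 / 200)\<^sup>2 < real q / real p \<and> real q / real p < 4 \<longrightarrow> ordinary m)"
    proof (intro conjI impI)
      assume "1 < real q / real p \<and> real q / real p < (11 / 10)\<^sup>2"
      then have ratio: "real q < (11 / 10)\<^sup>2 * real p" using p0 by (simp add: divide_less_eq)
      have good: "ramanujan m S" if S: "cayley_subset m S" "covalency m S \<le> 2 * k + 3" for S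
      proof (cases "covalency m S \<le> 2 * k + 1")
        case True
        then show ?thesis using ramanujan_below_band[OF band k1000] S by blast
      next
        case False
        \<comment> \<open>Parity excludes the value \<open>2 * k + 2\<close>.\<close>
        then have "covalency m S = 2 * k + 3" using S(2) odd_covalency[OF odd S(1)] by presburger
        then show ?thesis
          using ramanujan_at_band[OF band k1000 N[OF kN] pq(1,3,5,7) ratio S(1)] by blast
      qed
      obtain S S' where "cayley_subset m S" "covalency m S = 2 * k + 3"
        "cayley_subset m S'" "covalency m S' = (2 * k + 3) + 2" "\<not> ramanujan m S'"
        using ex(2) ex_not_ramanujan_above_band[OF band k1000] by auto
      then have "l_hat m = 2 * k + 3" using good by (intro l_hat_eqI[OF odd]) auto
      then show "exceptional m" using odd m15 l0 by (simp add: exceptional_def)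
    next
      assume "(399 / 200)\<^sup>2 < real q / real p \<and> real q / real p < 4"
      then have ratio: "(399 / 200)\<^sup>2 * real p < real q" using p0 by (simp add: less_divide_eq)
      have good: "ramanujan m S" if S: "cayley_subset m S" "covalency m S \<le> 2 * k + 1" for S
        using ramanujan_below_band[OF band k1000] S by blast
      obtain S S' where "cayley_subset m S" "covalency m S = 2 * k + 1"
        "cayley_subset m S'" "covalency m S' = (2 * k + 1) + 2" "\<not> ramanujan m S'"
        using ex(1) ex_not_ramanujan_at_band[OF band k1000 pq(1,6) p3 pq(8) ratio] by (auto simp: numeral_3_eq_3)
      then have "l_hat m = 2 * k + 1" using good by (intro l_hat_eqI[OF odd]) auto
      then show "ordinary m" using odd m15 l0 by (simp add: ordinary_def)
    qed
  qed
  then show "\<forall>\<^sub>F m :: nat in sequentially. \<forall>p q :: nat.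
        m = p * q \<and> int m \<in> J_set \<and> prime p \<and> odd p \<and> prime q \<and> odd q \<and> p < q \<and> q < 4 * p \<longrightarrow>
          (1 < real q / real p \<and> real q / real p < (11 / 10)\<^sup>2 \<longrightarrow> exceptional m) \<and>
          ((399 / 200)\<^sup>2 < real q / real p \<and> real q / real p < 4 \<longrightarrow> ordinary m)"
    unfolding eventually_sequentially by (metis Suc_le_eq)
qed (simp_all add: power2_eq_square)

end
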